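(* Let $G$ and $H$ be connected bipartite graphs of diameter at most $3$ with $G\approx H$. Then $|\mathrm{Hom}(G,T)| = |\mathrm{Hom}(H,T)|$ for every finite tree $T$.
   Context: All graphs are finite, simple and undirected. $\mathrm{Hom}(G,H)$ is the set of homomorphisms from $G$ to $H$. A tree is a connected acyclic graph; the diameter of a connected graph is the least $p$ such that any two distinct vertices are joined by a path of length at most $p$. For a vertex set $S$, $N(S)$ is the set of vertices adjacent to some vertex of $S$. Two connected bipartite graphs $G,H$ (with at least two vertices) are neighbourhood size equivalent, $G\approx H$, if there are bipartitions $(X^G,Y^G)$ of $G$ and $(X^H,Y^H)$ of $H$ with $|X^G|\le|Y^G|$, $|X^H|\le|Y^H|$, $|X^G|=|X^H|$, $|Y^G|=|Y^H|$, and a bijection $\eta$ from the power set of $X^G$ to the power set of $X^H$ such that for every $S\subseteq X^G$: $|\eta(S)|=|S|$ and $|N(\eta(S))| = |N(S)|$. *)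

theory Defs
  imports "Graph_Theory.Digraph_Component" "HOL-Library.FuncSet"
begin

text \<open>
  A finite simple undirected graph is a \<^locale>\<open>pair_graph\<close>: a finite, symmetric, loop-free
  set of pairs over a finite vertex set, each edge occurring in both orientations.
  \<^const>\<open>connected\<close> excludes the graph without vertices.
\<close>

text \<open>
  The library predicates \<^const>\<open>forest\<close> and \<^const>\<open>tree\<close> are meant for digraphs: they count
  the closed walk \<open>(u,v), (v,u)\<close> along a single edge as a cycle. An undirected cycle is a cycle
  in the library sense with at least three arcs.
\<close>

definition acyclic_graph :: "'a pair_pre_digraph \<Rightarrow> bool" where
  "acyclic_graph G \<longleftrightarrow> \<not> (\<exists>p. pre_digraph.cycle (with_proj G) p \<and> 3 \<le> length p)"

definition tree_graph :: "'a pair_pre_digraph \<Rightarrow> bool" where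
  "tree_graph G \<longleftrightarrow> pair_graph G \<and> connected (with_proj G) \<and> acyclic_graph G"

definition Hom :: "'a pair_pre_digraph \<Rightarrow> 'b pair_pre_digraph \<Rightarrow> ('a \<Rightarrow> 'b) set" where
  "Hom G H = {f \<in> pverts G \<rightarrow>\<^sub>E pverts H. \<forall>u v. (u, v) \<in> parcs G \<longrightarrow> (f u, f v) \<in> parcs H}"

text \<open>
  The length of \<^term>\<open>p\<close> is its number of edges. The value is meaningful for finite connected
  graphs only.
\<close>

definition diameter :: "'a pair_pre_digraph \<Rightarrow> nat" where
  "diameter G = (LEAST d. \<forall>u \<in> pverts G. \<forall>v \<in> pverts G. u \<noteq> v \<longrightarrow>
     (\<exists>p. pre_digraph.apath (with_proj G) u p v \<and> length p \<le> d))"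

definition bipartition :: "'a pair_pre_digraph \<Rightarrow> 'a set \<Rightarrow> 'a set \<Rightarrow> bool" where
  "bipartition G X Y \<longleftrightarrow> X \<union> Y = pverts G \<and> X \<inter> Y = {} \<and>
     (\<forall>(u, v) \<in> parcs G. u \<in> X \<and> v \<in> Y \<or> u \<in> Y \<and> v \<in> X)"

definition bipartite :: "'a pair_pre_digraph \<Rightarrow> bool" where
  "bipartite G \<longleftrightarrow> (\<exists>X Y. bipartition G X Y)"

definition nbhd :: "'a pair_pre_digraph \<Rightarrow> 'a set \<Rightarrow> 'a set" where
  "nbhd G S = {v \<in> pverts G. \<exists>u \<in> S. (u, v) \<in> parcs G}"

text \<open>The first two lines of the definition delimit the graphs on which the relation is defined.\<close>

definition nbhd_size_equiv ::
  "'a pair_pre_digraph \<Rightarrow> 'b pair_pre_digraph \<Rightarrow> bool" (infix \<open>\<approx>\<^sub>N\<close> 50) where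
  "G \<approx>\<^sub>N H \<longleftrightarrow>
     pair_graph G \<and> connected (with_proj G) \<and> bipartite G \<and> 2 \<le> card (pverts G) \<and>
     pair_graph H \<and> connected (with_proj H) \<and> bipartite H \<and> 2 \<le> card (pverts H) \<and>
     (\<exists>XG YG XH YH \<eta>.
        bipartition G XG YG \<and> bipartition H XH YH \<and>
        card XG \<le> card YG \<and> card XH \<le> card YH \<and>
        card XG = card XH \<and> card YG = card YH \<and>
        bij_betw \<eta> (Pow XG) (Pow XH) \<and>
        (\<forall>S \<subseteq> XG. card (\<eta> S) = card S \<and> card (nbhd H (\<eta> S)) = card (nbhd G S)))"

end

theory Submission
  imports Defs
begin

text \<open>
  In a connected bipartite graph of diameter at most 3 with parts \<open>X\<close> and \<open>Y\<close>, any two vertices in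
  the same part have a common neighbour. Since a tree has no cycles of length 3, 4 or 6, a
  homomorphism into it that is constant neither on \<open>X\<close> nor on \<open>Y\<close> has its image in a double star:
  there is exactly one arc \<open>(a, b)\<close> such that \<open>X\<close> is mapped into the neighbourhood of \<open>b\<close> and \<open>Y\<close>
  into that of \<open>a\<close>. Homomorphisms that are constant on a part are counted by \<open>|X|\<close> and \<open>|Y|\<close> alone.
  Those into the double star of \<open>(a, b)\<close> are classified by the set \<open>S \<subseteq> X\<close> of vertices not mapped
  to \<open>a\<close>: the neighbours of \<open>S\<close> must then go to \<open>b\<close> and all other choices are free, so their number
  is \<open>\<Sum>S\<subseteq>X. (deg b - 1)^|S| * (deg a)^(|Y| - |N(S)|)\<close>, which depends only on the pairs
  \<open>(|S|, |N(S)|)\<close>.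
\<close>

section \<open>Arcs of finite simple graphs\<close>

lemma pair_graph_arcs_sym:
  assumes "pair_graph G" "(u, v) \<in> parcs G"
  shows "(v, u) \<in> parcs G"
proof -
  interpret pair_graph G by fact
  show ?thesis using assms(2) pair_sym_arcs by (auto simp: symmetric_def dest: symD)
qed

lemma pair_graph_arcs_neq:
  assumes "pair_graph G" "(u, v) \<in> parcs G"
  shows "u \<noteq> v"
proof -
  interpret pair_graph G by fact
  show ?thesis using assms(2) pair_no_loops by fastforce
qed

lemma pair_graph_arcs_verts:
  assumes "pair_graph G" "(u, v) \<in> parcs G"
  shows "u \<in> pverts G" "v \<in> pverts G"
proof -
  interpret pair_graph G by fact
  show "u \<in> pverts G" "v \<in> pverts G" using assms(2) in_arcsD1 in_arcsD2 by auto
qed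

lemma pair_graph_finite:
  assumes "pair_graph G"
  shows "finite (pverts G)" "finite (parcs G)"
proof -
  interpret pair_graph G by fact
  show "finite (pverts G)" "finite (parcs G)" using pair_finite_verts pair_finite_arcs by auto
qed

section \<open>Diameter at most 3 and common neighbours\<close>

text \<open>The \<open>LEAST\<close> in \<open>diameter\<close> is attained: connectedness gives a
  path between any two vertices, and paths are no longer than the number of vertices.\<close>

lemma apath_length_le_diameter:
  assumes G: "pair_graph G" and "connected (with_proj G)"
    and uv: "u \<in> pverts G" "v \<in> pverts G" "u \<noteq> v"
  shows "\<exists>p. pre_digraph.apath (with_proj G) u p v \<and> length p \<le> diameter G"
proof -
  interpret pair_graph G by fact
  have "\<exists>p. apath u p v \<and> length p \<le> card (pverts G)" if "u \<in> pverts G" "v \<in> pverts G" for u v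
  proof -
    \<comment> \<open>\<open>connected\<close> speaks of reachability in the symmetric closure,
      which is \<open>G\<close> itself because its arcs are already symmetric.\<close>
    have "u \<rightarrow>\<^sup>*\<^bsub>with_proj (mk_symmetric (with_proj G))\<^esub> v"
      using assms(2) that by (auto simp: connected_def strongly_connected_def)
    then have "u \<rightarrow>\<^sup>*\<^bsub>with_proj G\<^esub> v"
      using reachable_mk_symmetric_eq[OF pair_sym_arcs] by simp
    then obtain p where "apath u p v" by (auto simp: reachable_apath)
    then show ?thesis using length_apath by blast
  qed
  then have "\<forall>u \<in> pverts G. \<forall>v \<in> pverts G. u \<noteq> v \<longrightarrow>
      (\<exists>p. apath u p v \<and> length p \<le> card (pverts G))" by blast
  from LeastI[where P = "\<lambda>d. \<forall>u \<in> pverts G. \<forall>v \<in> pverts G. u \<noteq> v \<longrightarrow>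
      (\<exists>p. apath u p v \<and> length p \<le> d)", OF this] uv
  show ?thesis unfolding diameter_def by blast
qed

text \<open>Parity: walks between vertices of one part have even length, so a path of length at most
  3 between distinct ones has length 2, and its midpoint is the witness. For \<open>u = v\<close>
  any neighbour of \<open>u\<close> will do; a path to a second vertex starts with one.\<close>

lemma diameter_le_3_common_neighbour:
  assumes G: "pair_graph G" and con: "connected (with_proj G)" and diam: "diameter G \<le> 3"
    and card: "2 \<le> card (pverts G)" and bip: "bipartition G X Y"
    and uv: "u \<in> X \<and> v \<in> X \<or> u \<in> Y \<and> v \<in> Y"
  shows "\<exists>w. (u, w) \<in> parcs G \<and> (v, w) \<in> parcs G"
proof -
  interpret pair_graph G by fact
  have V: "u \<in> pverts G" "v \<in> pverts G" using uv bip by (auto simp: bipartition_def)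
  show ?thesis
  proof (cases "u = v")
    case True
    obtain w where "w \<in> pverts G" "w \<noteq> u"
      using card by (metis One_nat_def Suc_1 card_le_Suc0_iff_eq not_less_eq_eq pair_finite_verts)
    then obtain p where "apath u p w"
      using apath_length_le_diameter[OF G con V(1)] by blast
    then obtain e where "e \<in> parcs G" "fst e = u"
      using \<open>w \<noteq> u\<close> by (cases p) (auto simp: apath_def awalk_simps)
    then show ?thesis using True by (cases e) auto
  next
    case False
    obtain p where p: "apath u p v" "length p \<le> 3"
      using apath_length_le_diameter[OF G con V False] diam by fastforce
    have walk: "awalk u p v" using p(1) by (simp add: apath_def)
    have bipE: "(x, y) \<in> parcs G \<Longrightarrow> (x \<in> X \<longleftrightarrow> y \<in> Y) \<and> (x \<in> Y \<longleftrightarrow> y \<in> X)" for x y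
      using bip by (fastforce simp: bipartition_def)
    have disj: "X \<inter> Y = {}" using bip by (simp add: bipartition_def)
    consider "p = []" | e where "p = [e]" | e f where "p = [e, f]" | e f g where "p = [e, f, g]"
      using p(2) by (cases p; cases "tl p"; cases "tl (tl p)"; cases "tl (tl (tl p))") auto
    then show ?thesis
    proof cases
      case 1
      then show ?thesis using walk False by (simp add: awalk_simps)
    next
      case 2
      then have "(u, v) \<in> parcs G" using walk by (cases e) (auto simp: awalk_simps)
      then show ?thesis using bipE disj uv by blast
    next
      case 3
      then obtain w where "(u, w) \<in> parcs G" "(w, v) \<in> parcs G"
        using walk by (cases e; cases f) (auto simp: awalk_simps)
      then show ?thesis using pair_graph_arcs_sym[OF G] by blast
    next
      case 4
      then obtain w z where "(u, w) \<in> parcs G" "(w, z) \<in> parcs G" "(z, v) \<in> parcs G"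
        using walk by (cases e; cases f; cases g) (auto simp: awalk_simps)
      then show ?thesis using bipE disj uv by (metis disjoint_iff)
    qed
  qed
qed

lemma nbhd_singleton [simp]:
  "pair_graph G \<Longrightarrow> v \<in> nbhd G {u} \<longleftrightarrow> (u, v) \<in> parcs G"
  by (auto simp: nbhd_def dest: pair_graph_arcs_verts)

section \<open>Counting maps by conditions on the images of the two parts\<close>

text \<open>Precomposition with a bijection that takes \<open>X\<close> to \<open>X'\<close> and
  \<open>Y\<close> to \<open>Y'\<close> leaves the images of both parts unchanged. This will show
  that the number of flat maps depends on the sizes of the parts alone.\<close>

lemma card_PiE_image_cong:
  assumes fin: "finite X" "finite Y" "finite X'" "finite Y'"
    and disj: "X \<inter> Y = {}" "X' \<inter> Y' = {}"
    and card: "card X = card X'" "card Y = card Y'"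
  shows "card {f \<in> X \<union> Y \<rightarrow>\<^sub>E W. P (f ` X) (f ` Y)} =
    card {f \<in> X' \<union> Y' \<rightarrow>\<^sub>E W. P (f ` X') (f ` Y')}"
proof -
  obtain g h where g: "bij_betw g X X'" and h: "bij_betw h Y Y'"
    using fin card by (meson finite_same_card_bij)
  define \<phi> where "\<phi> v = (if v \<in> X then g v else h v)" for v
  have \<phi>X: "bij_betw \<phi> X X'" using g by (simp add: \<phi>_def cong: bij_betw_cong)
  have \<phi>Y: "bij_betw \<phi> Y Y'"
    by (rule iffD2[OF bij_betw_cong h]) (use disj in \<open>auto simp: \<phi>_def\<close>)
  have \<phi>: "bij_betw \<phi> (X \<union> Y) (X' \<union> Y')" using bij_betw_combine[OF \<phi>X \<phi>Y disj(2)] .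
  define \<psi> where "\<psi> = inv_into (X \<union> Y) \<phi>"
  have \<psi>\<phi>: "\<psi> (\<phi> v) = v" if "v \<in> X \<union> Y" for v
    using \<phi> that by (simp add: \<psi>_def bij_betw_inv_into_left)
  have \<phi>\<psi>: "\<phi> (\<psi> v) = v" if "v \<in> X' \<union> Y'" for v
    using \<phi> that by (simp add: \<psi>_def bij_betw_inv_into_right)
  have im: "\<phi> ` X = X'" "\<phi> ` Y = Y'" using \<phi>X \<phi>Y by (auto simp: bij_betw_def)
  have \<psi>im: "\<psi> ` X' = X" "\<psi> ` Y' = Y"
    using \<psi>\<phi> by (force simp: im[symmetric] image_image)+
  have 1: "restrict (f \<circ> \<psi>) (X' \<union> Y') ` X' = f ` X" "restrict (f \<circ> \<psi>) (X' \<union> Y') ` Y' = f ` Y"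
    for f :: "'a \<Rightarrow> 'c"
    by (simp_all add: image_image flip: \<psi>im)
  have 2: "restrict (f \<circ> \<phi>) (X \<union> Y) ` X = f ` X'" "restrict (f \<circ> \<phi>) (X \<union> Y) ` Y = f ` Y'"
    for f :: "'b \<Rightarrow> 'c"
    by (simp_all add: image_image flip: im)
  show ?thesis
  proof (rule bij_betw_same_card[OF bij_betw_byWitness[where f = "\<lambda>f. restrict (f \<circ> \<psi>) (X' \<union> Y')"
          and f' = "\<lambda>f. restrict (f \<circ> \<phi>) (X \<union> Y)"]])
    show "\<forall>f\<in>{f \<in> X \<union> Y \<rightarrow>\<^sub>E W. P (f ` X) (f ` Y)}.
        restrict (restrict (f \<circ> \<psi>) (X' \<union> Y') \<circ> \<phi>) (X \<union> Y) = f"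
      using \<psi>\<phi> im by (auto intro!: extensionalityI[where A = "X \<union> Y"] simp: PiE_def)
    show "\<forall>f\<in>{f \<in> X' \<union> Y' \<rightarrow>\<^sub>E W. P (f ` X') (f ` Y')}.
        restrict (restrict (f \<circ> \<phi>) (X \<union> Y) \<circ> \<psi>) (X' \<union> Y') = f"
      using \<phi>\<psi> \<psi>im by (auto intro!: extensionalityI[where A = "X' \<union> Y'"] simp: PiE_def)
    have mem: "v \<in> X' \<union> Y' \<Longrightarrow> \<psi> v \<in> X \<union> Y" "w \<in> X \<union> Y \<Longrightarrow> \<phi> w \<in> X' \<union> Y'" for v w
      using im \<psi>im by blast+
    show "(\<lambda>f. restrict (f \<circ> \<psi>) (X' \<union> Y')) ` {f \<in> X \<union> Y \<rightarrow>\<^sub>E W. P (f ` X) (f ` Y)}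
        \<subseteq> {f \<in> X' \<union> Y' \<rightarrow>\<^sub>E W. P (f ` X') (f ` Y')}"
      unfolding image_subset_iff mem_Collect_eq 1 using mem(1)
      by (simp only: PiE_iff restrict_apply' o_apply restrict_extensional Ball_Collect) auto
    show "(\<lambda>f. restrict (f \<circ> \<phi>) (X \<union> Y)) ` {f \<in> X' \<union> Y' \<rightarrow>\<^sub>E W. P (f ` X') (f ` Y')}
        \<subseteq> {f \<in> X \<union> Y \<rightarrow>\<^sub>E W. P (f ` X) (f ` Y)}"
      unfolding image_subset_iff mem_Collect_eq 2 using mem(2)
      by (simp only: PiE_iff restrict_apply' o_apply restrict_extensional Ball_Collect) auto
  qed
qed

section \<open>Graphs without short cycles\<close>

text \<open>\<open>no_C3\<close> carries no distinctness condition because a closed walk of length 3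
  in a loop-free graph is already a triangle.\<close>

locale short_cycle_free = pair_graph T for T :: "'c pair_pre_digraph" +
  assumes no_C3: "(a, b) \<in> parcs T \<Longrightarrow> (b, c) \<in> parcs T \<Longrightarrow> (c, a) \<in> parcs T \<Longrightarrow> False"
    and no_C4: "(a, b) \<in> parcs T \<Longrightarrow> (b, c) \<in> parcs T \<Longrightarrow> (c, d) \<in> parcs T \<Longrightarrow> (d, a) \<in> parcs T \<Longrightarrow>
      distinct [a, b, c, d] \<Longrightarrow> False"
    and no_C6: "(a, b) \<in> parcs T \<Longrightarrow> (b, c) \<in> parcs T \<Longrightarrow> (c, d) \<in> parcs T \<Longrightarrow> (d, e) \<in> parcs T \<Longrightarrow>
      (e, f) \<in> parcs T \<Longrightarrow> (f, a) \<in> parcs T \<Longrightarrow> distinct [a, b, c, d, e, f] \<Longrightarrow> False"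
begin

lemma pair_graph: "pair_graph T" ..

lemmas arcs_sym = pair_graph_arcs_sym[OF pair_graph]
  and arcs_neq = pair_graph_arcs_neq[OF pair_graph]
  and arcs_verts = pair_graph_arcs_verts[OF pair_graph]

lemma unique_common_neighbour:
  assumes "(a, b) \<in> parcs T" "(a', b) \<in> parcs T" "(a, d) \<in> parcs T" "(a', d) \<in> parcs T" "a \<noteq> a'"
  shows "b = d"
proof (rule ccontr)
  assume "b \<noteq> d"
  then have "distinct [a, b, a', d]" using assms arcs_neq by auto
  then show False using no_C4[of a b a' d] assms arcs_sym by blast
qed

text \<open>A Helly-type property: \<open>a\<close>, \<open>a'\<close>, \<open>a''\<close> pairwise
  have common neighbours \<open>b\<close>, \<open>c\<close>, \<open>d\<close>. If \<open>b\<close>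
  were not adjacent to \<open>a''\<close>, then \<open>a b a' d a'' c\<close> would be a
  6-cycle.\<close>

lemma common_neighbour_of_pairs:
  assumes b: "(a, b) \<in> parcs T" "(a', b) \<in> parcs T" "a \<noteq> a'"
    and c: "(a, c) \<in> parcs T" "(a'', c) \<in> parcs T"
    and d: "(a', d) \<in> parcs T" "(a'', d) \<in> parcs T"
  shows "(a'', b) \<in> parcs T"
proof (rule ccontr)
  assume *: "(a'', b) \<notin> parcs T"
  then have ne: "a'' \<noteq> a" "a'' \<noteq> a'" "c \<noteq> b" "d \<noteq> b" using b c d by auto
  then have "c \<noteq> d" using unique_common_neighbour b c d by metis
  \<comment> \<open>Each equality would produce a triangle; for example, \<open>a'' = b\<close>
    makes \<open>a\<close>, \<open>b\<close>, \<open>c\<close> one.\<close>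
  moreover have "a'' \<noteq> b" "a' \<noteq> c" "a \<noteq> d"
    using no_C3 b c d arcs_sym by metis+
  ultimately have "distinct [a, b, a', d, a'', c]" using b c d ne arcs_neq by auto
  then show False using no_C6[of a b a' d a'' c] b c d arcs_sym by blast
qed

end

lemma tree_graph_short_cycle_free:
  assumes "tree_graph T"
  shows "short_cycle_free T"
proof -
  interpret pair_graph T using assms by (simp add: tree_graph_def)
  have no_cycle: "\<not> (cycle p \<and> 3 \<le> length p)" for p
    using assms by (auto simp: tree_graph_def acyclic_graph_def)
  show ?thesis
  proof
    show False if "(a, b) \<in> parcs T" "(b, c) \<in> parcs T" "(c, a) \<in> parcs T" for a b c
    proof -
      have "distinct [a, b, c]" using that pair_no_loops by fastforce
      then show False
        using no_cycle[of "[(a, b), (b, c), (c, a)]"] that in_arcsD1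
        by (auto simp: cycle_def awalk_def)
    qed
    show False if "(a, b) \<in> parcs T" "(b, c) \<in> parcs T" "(c, d) \<in> parcs T" "(d, a) \<in> parcs T"
      "distinct [a, b, c, d]" for a b c d
      using no_cycle[of "[(a, b), (b, c), (c, d), (d, a)]"] that in_arcsD1
      by (auto simp: cycle_def awalk_def)
    show False if "(a, b) \<in> parcs T" "(b, c) \<in> parcs T" "(c, d) \<in> parcs T" "(d, e) \<in> parcs T"
      "(e, f) \<in> parcs T" "(f, a) \<in> parcs T" "distinct [a, b, c, d, e, f]" for a b c d e f
      using no_cycle[of "[(a, b), (b, c), (c, d), (d, e), (e, f), (f, a)]"] that in_arcsD1
      by (auto simp: cycle_def awalk_def)
  qed
qed

section \<open>Maps constant on a part and maps into a double star\<close>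

text \<open>The edges of the source graph do not occur here, and the condition concerns only the
  images of \<open>X\<close> and \<open>Y\<close>, as \<open>card_PiE_image_cong\<close> demands.
  For the graphs considered these are exactly the homomorphisms constant on a part, by
  \<open>flat_maps_eq\<close>.\<close>

definition flat_maps :: "'a set \<Rightarrow> 'a set \<Rightarrow> 'c pair_pre_digraph \<Rightarrow> ('a \<Rightarrow> 'c) set" where
  "flat_maps X Y T = {f \<in> X \<union> Y \<rightarrow>\<^sub>E pverts T.
     ((\<exists>c. f ` X \<subseteq> {c}) \<or> (\<exists>c. f ` Y \<subseteq> {c})) \<and> f ` X \<times> f ` Y \<subseteq> parcs T}"

text \<open>The double star has the central edge \<open>ab\<close>. Orientation matters: the arc
  \<open>(a, b)\<close> lets \<open>a\<close> be a value on \<open>X\<close> and \<open>b\<close> a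
  value on \<open>Y\<close>, the arc \<open>(b, a)\<close> the reverse.\<close>

definition star_maps ::
  "'a pair_pre_digraph \<Rightarrow> 'a set \<Rightarrow> 'a set \<Rightarrow> 'c pair_pre_digraph \<Rightarrow> 'c \<Rightarrow> 'c \<Rightarrow> ('a \<Rightarrow> 'c) set" where
  "star_maps G X Y T a b = {f \<in> Hom G T. f ` X \<subseteq> nbhd T {b} \<and> f ` Y \<subseteq> nbhd T {a}}"

text \<open>\<open>common\<close> is what remains of the diameter bound. Its instance
  \<open>u = v\<close> says that no vertex is isolated.\<close>

locale bipartite_to_tree = short_cycle_free T
  for T :: "'c pair_pre_digraph" +
  fixes G :: "'a pair_pre_digraph" and X Y :: "'a set"
  assumes G: "pair_graph G" and bip: "bipartition G X Y"
    and common: "u \<in> X \<and> v \<in> X \<or> u \<in> Y \<and> v \<in> Y \<Longrightarrow> \<exists>w. (u, w) \<in> parcs G \<and> (v, w) \<in> parcs G"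
begin

lemma bip_verts: "pverts G = X \<union> Y" and bip_disj: "X \<inter> Y = {}"
  using bip by (auto simp: bipartition_def)

lemma bip_arcs: "(u, v) \<in> parcs G \<Longrightarrow> u \<in> X \<and> v \<in> Y \<or> u \<in> Y \<and> v \<in> X"
  using bip by (auto simp: bipartition_def)

lemma finite_sides: "finite X" "finite Y"
  using pair_graph_finite[OF G] bip_verts by auto

lemma Hom_iff:
  "f \<in> Hom G T \<longleftrightarrow> f \<in> X \<union> Y \<rightarrow>\<^sub>E pverts T \<and>
     (\<forall>x\<in>X. \<forall>y\<in>Y. (x, y) \<in> parcs G \<longrightarrow> (f x, f y) \<in> parcs T)"
proof -
  have "(f u, f v) \<in> parcs T"
    if f: "\<forall>x\<in>X. \<forall>y\<in>Y. (x, y) \<in> parcs G \<longrightarrow> (f x, f y) \<in> parcs T" and uv: "(u, v) \<in> parcs G" for u v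
    using bip_arcs[OF uv] f uv arcs_sym[of "f v" "f u"] pair_graph_arcs_sym[OF G uv] by blast
  then show ?thesis by (auto simp: Hom_def bip_verts)
qed

lemma finite_Hom: "finite (Hom G T)"
  by (rule finite_subset[of _ "pverts G \<rightarrow>\<^sub>E pverts T"])
    (auto simp: Hom_def intro!: finite_PiE pair_graph_finite[OF G] pair_graph_finite[OF pair_graph])

lemma nbr_X: "x \<in> X \<Longrightarrow> x' \<in> X \<Longrightarrow> \<exists>y\<in>Y. (x, y) \<in> parcs G \<and> (x', y) \<in> parcs G"
  using common[of x x'] bip_arcs bip_disj by blast

lemma nbr_Y: "y \<in> Y \<Longrightarrow> y' \<in> Y \<Longrightarrow> \<exists>x\<in>X. (x, y) \<in> parcs G \<and> (x, y') \<in> parcs G"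
  using common[of y y'] bip_arcs bip_disj pair_graph_arcs_sym[OF G] by blast

text \<open>Given \<open>x\<close> in \<open>X\<close> and \<open>y\<close> in \<open>Y\<close>,
  take neighbours \<open>y'\<close> of \<open>x\<close> and \<open>x'\<close> of \<open>y\<close>.
  If \<open>f\<close> is constant on \<open>X\<close>, the arc \<open>(f x', f y)\<close> equals
  \<open>(f x, f y)\<close>; if it is constant on \<open>Y\<close>, the arc
  \<open>(f x, f y')\<close> does. So the image of \<open>X\<close> is completely joined to that of
  \<open>Y\<close>.\<close>

lemma flat_maps_eq:
  "flat_maps X Y T = {f \<in> Hom G T. (\<exists>c. f ` X \<subseteq> {c}) \<or> (\<exists>c. f ` Y \<subseteq> {c})}"
proof -
  have arc: "(f x, f y) \<in> parcs T"
    if f: "f \<in> Hom G T" and c: "(\<exists>c. f ` X \<subseteq> {c}) \<or> (\<exists>c. f ` Y \<subseteq> {c})"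
      and "x \<in> X" "y \<in> Y" for f x y
  proof -
    obtain x' where x': "x' \<in> X" "(x', y) \<in> parcs G" using nbr_Y \<open>y \<in> Y\<close> by blast
    obtain y' where y': "y' \<in> Y" "(x, y') \<in> parcs G" using nbr_X \<open>x \<in> X\<close> by blast
    have arcs: "(f x', f y) \<in> parcs T" "(f x, f y') \<in> parcs T"
      using f x' y' by (auto simp: Hom_def)
    have "f x = f x' \<or> f y = f y'" using c x' y' that(3,4) by blast
    then show ?thesis using arcs by metis
  qed
  show ?thesis
  proof (intro equalityI subsetI)
    fix f assume "f \<in> flat_maps X Y T"
    then show "f \<in> {f \<in> Hom G T. (\<exists>c. f ` X \<subseteq> {c}) \<or> (\<exists>c. f ` Y \<subseteq> {c})}"
      unfolding flat_maps_def mem_Collect_eq Hom_iff by blast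
  next
    fix f assume "f \<in> {f \<in> Hom G T. (\<exists>c. f ` X \<subseteq> {c}) \<or> (\<exists>c. f ` Y \<subseteq> {c})}"
    then have f: "f \<in> Hom G T" and c: "(\<exists>c. f ` X \<subseteq> {c}) \<or> (\<exists>c. f ` Y \<subseteq> {c})" by simp_all
    have "f ` X \<times> f ` Y \<subseteq> parcs T" using arc[OF f c] by auto
    then show "f \<in> flat_maps X Y T"
      unfolding flat_maps_def mem_Collect_eq using f c by (simp only: Hom_iff)
  qed
qed

lemma non_flatE:
  assumes "f \<in> Hom G T" "f \<notin> flat_maps X Y T"
  obtains x x' y y' where "x \<in> X" "x' \<in> X" "f x \<noteq> f x'" "y \<in> Y" "y' \<in> Y" "f y \<noteq> f y'"
proof -
  have non_const: "\<exists>u\<in>S. \<exists>v\<in>S. f u \<noteq> f v" if S: "\<And>c. \<not> f ` S \<subseteq> {c}" for S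
  proof -
    obtain u where "u \<in> S" using S by blast
    then show ?thesis using S[of "f u"] by auto
  qed
  have "\<not> f ` X \<subseteq> {c}" "\<not> f ` Y \<subseteq> {c}" for c using assms by (auto simp: flat_maps_eq)
  then obtain x x' y y' where "x \<in> X" "x' \<in> X" "f x \<noteq> f x'" "y \<in> Y" "y' \<in> Y" "f y \<noteq> f y'"
    using non_const by meson
  then show ?thesis by (rule that)
qed

section \<open>Each non-flat homomorphism determines one double star\<close>

text \<open>Choose \<open>x1\<close>, \<open>x2\<close> in \<open>X\<close> with different images
  and a common neighbour \<open>y0\<close>. Any \<open>z\<close> in \<open>X\<close> has a common
  neighbour with each of them, so \<open>common_neighbour_of_pairs\<close> makes \<open>f z\<close>
  adjacent to \<open>f y0\<close>, which serves as \<open>b\<close>. Symmetrically, a common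
  neighbour \<open>x0\<close> of \<open>y1\<close> and \<open>y2\<close> yields \<open>a\<close> as
  \<open>f x0\<close>.\<close>

lemma non_flat_star:
  assumes f: "f \<in> Hom G T" and nf: "f \<notin> flat_maps X Y T"
  shows "\<exists>(a, b)\<in>parcs T. f \<in> star_maps G X Y T a b"
proof -
  have arc: "(f x, f y) \<in> parcs T" if "x \<in> X" "y \<in> Y" "(x, y) \<in> parcs G" for x y
    using f that by (auto simp: Hom_def)
  then have arc': "(f y, f x) \<in> parcs T" if "x \<in> X" "y \<in> Y" "(x, y) \<in> parcs G" for x y
    using that arcs_sym by blast
  obtain x1 x2 y1 y2 where x: "x1 \<in> X" "x2 \<in> X" "f x1 \<noteq> f x2"
    and y: "y1 \<in> Y" "y2 \<in> Y" "f y1 \<noteq> f y2"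
    using f nf by (rule non_flatE)
  obtain x0 where x0: "x0 \<in> X" "(x0, y1) \<in> parcs G" "(x0, y2) \<in> parcs G" using nbr_Y y by blast
  obtain y0 where y0: "y0 \<in> Y" "(x1, y0) \<in> parcs G" "(x2, y0) \<in> parcs G" using nbr_X x by blast
  have X: "(f z, f y0) \<in> parcs T" if "z \<in> X" for z
  proof -
    obtain u where u: "u \<in> Y" "(x1, u) \<in> parcs G" "(z, u) \<in> parcs G"
      using nbr_X[OF x(1) \<open>z \<in> X\<close>] by blast
    obtain v where v: "v \<in> Y" "(x2, v) \<in> parcs G" "(z, v) \<in> parcs G"
      using nbr_X[OF x(2) \<open>z \<in> X\<close>] by blast
    show ?thesis
      by (rule common_neighbour_of_pairs[of "f x1" "f y0" "f x2" "f u" "f z" "f v"])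
        (fact x(3) | rule arc, fact+)+
  qed
  have Y: "(f x0, f z) \<in> parcs T" if "z \<in> Y" for z
  proof -
    obtain u where u: "u \<in> X" "(u, y1) \<in> parcs G" "(u, z) \<in> parcs G"
      using nbr_Y[OF y(1) \<open>z \<in> Y\<close>] by blast
    obtain v where v: "v \<in> X" "(v, y2) \<in> parcs G" "(v, z) \<in> parcs G"
      using nbr_Y[OF y(2) \<open>z \<in> Y\<close>] by blast
    have "(f z, f x0) \<in> parcs T"
      by (rule common_neighbour_of_pairs[of "f y1" "f x0" "f y2" "f u" "f z" "f v"])
        (fact y(3) | rule arc', fact+)+
    then show ?thesis by (rule arcs_sym)
  qed
  \<comment> \<open>The two centres are adjacent because \<open>x0\<close> is itself one of the
    vertices \<open>z\<close> of \<open>X\<close>.\<close>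
  have "(f x0, f y0) \<in> parcs T" using X x0 by blast
  moreover have "f \<in> star_maps G X Y T (f x0) (f y0)"
    using f X Y arcs_sym by (auto simp: star_maps_def pair_graph)
  ultimately show ?thesis by blast
qed

text \<open>Both \<open>b\<close> and \<open>b'\<close> are common neighbours of two distinct values
  on \<open>X\<close>, so they coincide; likewise \<open>a\<close> and \<open>a'\<close> for two
  distinct values on \<open>Y\<close>.\<close>

lemma star_maps_unique:
  assumes "f \<in> star_maps G X Y T a b" "f \<in> star_maps G X Y T a' b'" "f \<notin> flat_maps X Y T"
  shows "a = a' \<and> b = b'"
proof -
  have "f \<in> Hom G T" using assms(1) by (simp add: star_maps_def)
  then obtain x1 x2 y1 y2 where x: "x1 \<in> X" "x2 \<in> X" "f x1 \<noteq> f x2"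
    and y: "y1 \<in> Y" "y2 \<in> Y" "f y1 \<noteq> f y2"
    using assms(3) by (rule non_flatE)
  have "(b, f z) \<in> parcs T \<and> (b', f z) \<in> parcs T" if "z \<in> X" for z
    using assms(1,2) that by (auto simp: star_maps_def image_subset_iff pair_graph)
  moreover have "(a, f z) \<in> parcs T \<and> (a', f z) \<in> parcs T" if "z \<in> Y" for z
    using assms(1,2) that by (auto simp: star_maps_def image_subset_iff pair_graph)
  ultimately show ?thesis
    using unique_common_neighbour[of "f x1" b "f x2" b'] unique_common_neighbour[of "f y1" a "f y2" a']
      x y arcs_sym by blast
qed

section \<open>Counting homomorphisms\<close>

text \<open>Once \<open>S\<close> is fixed, the values can be chosen independently, so the fibre is
  a product. A vertex of \<open>Y\<close> outside \<open>nbhd G S\<close> has only neighbours sent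
  to \<open>a\<close>, hence may go to any neighbour of \<open>a\<close>.\<close>

lemma star_maps_fibre:
  assumes ab: "(a, b) \<in> parcs T" and S: "S \<subseteq> X"
  shows "{f \<in> star_maps G X Y T a b. {x \<in> X. f x \<noteq> a} = S} =
    (\<Pi>\<^sub>E v \<in> X \<union> Y. if v \<in> S then nbhd T {b} - {a} else if v \<in> X then {a}
       else if v \<in> nbhd G S then {b} else nbhd T {a})" (is "?L = PiE _ ?F")
proof (intro equalityI subsetI)
  fix f assume "f \<in> ?L"
  then have f: "f \<in> Hom G T" and fX: "\<And>x. x \<in> X \<Longrightarrow> (b, f x) \<in> parcs T"
    and fY: "\<And>y. y \<in> Y \<Longrightarrow> (a, f y) \<in> parcs T" and fS: "{x \<in> X. f x \<noteq> a} = S"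
    by (auto simp: star_maps_def image_subset_iff pair_graph)
  have "f v = b" if v: "v \<in> nbhd G S" "v \<in> Y" for v
  proof -
    obtain u where u: "u \<in> S" "(u, v) \<in> parcs G" using v by (auto simp: nbhd_def)
    then have "(f u, f v) \<in> parcs T" "u \<in> X" "f u \<noteq> a" using f fS by (auto simp: Hom_def)
    \<comment> \<open>Both \<open>f v\<close> and \<open>b\<close> are common neighbours of the
      distinct vertices \<open>a\<close> and \<open>f u\<close>.\<close>
    then show ?thesis using unique_common_neighbour[of a "f v" "f u" b] fX fY ab v arcs_sym by blast
  qed
  then show "f \<in> PiE (X \<union> Y) ?F"
    using f fX fY fS by (auto simp: PiE_iff Hom_iff pair_graph)
next
  fix f assume f: "f \<in> PiE (X \<union> Y) ?F"
  have FX: "f x = a \<or> x \<in> S \<and> (b, f x) \<in> parcs T \<and> f x \<noteq> a" if "x \<in> X" for x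
    using PiE_mem[OF f, of x] that by (auto split: if_splits simp: pair_graph)
  have FS: "(b, f x) \<in> parcs T \<and> f x \<noteq> a" if "x \<in> S" for x
    using PiE_mem[OF f, of x] that S by (auto split: if_splits simp: pair_graph)
  have FY: "f y = b \<or> y \<notin> nbhd G S \<and> (a, f y) \<in> parcs T" if "y \<in> Y" for y
    using PiE_mem[OF f, of y] that S bip_disj by (auto split: if_splits simp: pair_graph)
  have "f \<in> X \<union> Y \<rightarrow>\<^sub>E pverts T"
    using f FX FY ab arcs_verts by (auto simp: PiE_iff) metis+
  moreover have "(f x, f y) \<in> parcs T" if "x \<in> X" "y \<in> Y" "(x, y) \<in> parcs G" for x y
  proof (cases "x \<in> S")
    case True
    then have "y \<in> nbhd G S" using that bip_verts by (auto simp: nbhd_def)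
    then show ?thesis using FY FS True that arcs_sym by blast
  next
    case False
    then show ?thesis using FX FY ab that by metis
  qed
  ultimately show "f \<in> ?L"
    unfolding star_maps_def using FX FY FS ab arcs_sym[OF ab] S
    by (simp add: Hom_iff image_subset_iff pair_graph) blast
qed

text \<open>The maps are grouped by the set \<open>S\<close> of vertices of \<open>X\<close> not
  sent to \<open>a\<close>. If \<open>b\<close> is a leaf of \<open>T\<close>, the first base is 0,
  and the convention \<open>0 ^ 0 = 1\<close> leaves just the summand of the empty set.\<close>

lemma card_star_maps:
  assumes ab: "(a, b) \<in> parcs T"
  shows "card (star_maps G X Y T a b) =
    (\<Sum>S\<in>Pow X. card (nbhd T {b} - {a}) ^ card S * card (nbhd T {a}) ^ (card Y - card (nbhd G S)))"
proof -
  let ?fib = "\<lambda>S. {f \<in> star_maps G X Y T a b. {x \<in> X. f x \<noteq> a} = S}"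
  have fin: "finite (star_maps G X Y T a b)"
    using finite_Hom by (simp add: star_maps_def)
  have "card (star_maps G X Y T a b) = (\<Sum>S\<in>Pow X. card (?fib S))"
    unfolding card_eq_sum using fin finite_sides
    by (intro sum.group[symmetric]) auto
  also have "\<dots> = (\<Sum>S\<in>Pow X. card (nbhd T {b} - {a}) ^ card S *
      card (nbhd T {a}) ^ (card Y - card (nbhd G S)))"
  proof (rule sum.cong[OF refl])
    fix S assume "S \<in> Pow X"
    then have S: "S \<subseteq> X" by simp
    \<comment> \<open>This inclusion makes the truncated subtraction in the exponent exact.\<close>
    have NS: "nbhd G S \<subseteq> Y" using S bip_arcs bip_disj by (fastforce simp: nbhd_def)
    let ?F = "\<lambda>v. if v \<in> S then nbhd T {b} - {a} else if v \<in> X then {a}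
       else if v \<in> nbhd G S then {b} else nbhd T {a}"
    have "card (?fib S) = (\<Prod>v\<in>X \<union> Y. card (?F v))"
      using star_maps_fibre[OF ab S] finite_sides by (simp add: card_PiE)
    also have "\<dots> = (\<Prod>v\<in>X. card (?F v)) * (\<Prod>v\<in>Y. card (?F v))"
      using finite_sides bip_disj by (rule prod.union_disjoint)
    also have "(\<Prod>v\<in>X. card (?F v)) = (\<Prod>v\<in>X. if v \<in> S then card (nbhd T {b} - {a}) else 1)"
      by (rule prod.cong) auto
    also have "\<dots> = card (nbhd T {b} - {a}) ^ card S"
      using finite_sides S by (simp add: prod.If_cases Int_absorb1)
    also have "(\<Prod>v\<in>Y. card (?F v)) = (\<Prod>v\<in>Y. if v \<in> nbhd G S then 1 else card (nbhd T {a}))"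
      using S bip_disj by (intro prod.cong) auto
    also have "\<dots> = card (nbhd T {a}) ^ card (Y - nbhd G S)"
      using finite_sides by (simp add: prod.If_cases Diff_eq)
    also have "card (Y - nbhd G S) = card Y - card (nbhd G S)"
      using NS finite_sides by (meson card_Diff_subset finite_subset)
    finally show "card (?fib S) = card (nbhd T {b} - {a}) ^ card S *
      card (nbhd T {a}) ^ (card Y - card (nbhd G S))" .
  qed
  finally show ?thesis .
qed

text \<open>By \<open>non_flat_star\<close> and \<open>star_maps_unique\<close> the non-flat
  homomorphisms split into disjoint classes, one per arc of \<open>T\<close>. The flat maps removed
  from each class form a subset of it, so the subtraction is exact, and they are again described by
  images of the parts alone.\<close>

lemma card_Hom:
  "card (Hom G T) = card (flat_maps X Y T) + (\<Sum>(a, b)\<in>parcs T. card (star_maps G X Y T a b) -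
     card {f \<in> flat_maps X Y T. f ` X \<subseteq> nbhd T {b} \<and> f ` Y \<subseteq> nbhd T {a}})"
proof -
  let ?st = "\<lambda>(a, b). star_maps G X Y T a b - flat_maps X Y T"
  have sub: "flat_maps X Y T \<subseteq> Hom G T" by (auto simp: flat_maps_eq)
  have fin: "finite (flat_maps X Y T)" "finite (star_maps G X Y T a b)" for a b
    using finite_Hom by (simp_all add: flat_maps_eq star_maps_def)
  have "Hom G T = flat_maps X Y T \<union> (\<Union>e\<in>parcs T. ?st e)"
    using sub non_flat_star by (auto simp: star_maps_def; fastforce)
  then have "card (Hom G T) = card (flat_maps X Y T) + card (\<Union>e\<in>parcs T. ?st e)"
    using fin pair_finite_arcs by (simp only:) (subst card_Un_disjoint, auto)
  also have "card (\<Union>e\<in>parcs T. ?st e) = (\<Sum>e\<in>parcs T. card (?st e))"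
  proof (rule card_UN_disjoint)
    show "\<forall>e\<in>parcs T. \<forall>e'\<in>parcs T. e \<noteq> e' \<longrightarrow> ?st e \<inter> ?st e' = {}"
      using star_maps_unique by fastforce
  qed (use fin pair_finite_arcs in auto)
  also have "\<dots> = (\<Sum>(a, b)\<in>parcs T. card (star_maps G X Y T a b) -
     card {f \<in> flat_maps X Y T. f ` X \<subseteq> nbhd T {b} \<and> f ` Y \<subseteq> nbhd T {a}})"
  proof (rule sum.cong[OF refl], clarify)
    fix a b
    have "star_maps G X Y T a b \<inter> flat_maps X Y T =
        {f \<in> flat_maps X Y T. f ` X \<subseteq> nbhd T {b} \<and> f ` Y \<subseteq> nbhd T {a}}"
      using sub by (auto simp: star_maps_def)
    then show "card (star_maps G X Y T a b - flat_maps X Y T) = card (star_maps G X Y T a b) -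
        card {f \<in> flat_maps X Y T. f ` X \<subseteq> nbhd T {b} \<and> f ` Y \<subseteq> nbhd T {a}}"
      using fin by (simp add: card_Diff_subset_Int)
  qed
  finally show ?thesis .
qed

end

section \<open>Comparison of the two counts\<close>

theorem theorem13:
  fixes G :: "'a pair_pre_digraph" and H :: "'b pair_pre_digraph" and T :: "'c pair_pre_digraph"
  assumes "pair_graph G" and "connected (with_proj G)" and "bipartite G" and "diameter G \<le> 3"
    and "pair_graph H" and "connected (with_proj H)" and "bipartite H" and "diameter H \<le> 3"
    and "G \<approx>\<^sub>N H"
    and "tree_graph T"
  shows "card (Hom G T) = card (Hom H T)"
proof -
  interpret short_cycle_free T using assms(10) by (rule tree_graph_short_cycle_free)
  have cards: "2 \<le> card (pverts G)" "2 \<le> card (pverts H)"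
    using assms(9) by (auto simp: nbhd_size_equiv_def)
  obtain X Y X' Y' \<eta> where bip: "bipartition G X Y" "bipartition H X' Y'"
    and XY: "card X = card X'" "card Y = card Y'" and \<eta>: "bij_betw \<eta> (Pow X) (Pow X')"
    and size: "\<And>S. S \<subseteq> X \<Longrightarrow> card (\<eta> S) = card S \<and> card (nbhd H (\<eta> S)) = card (nbhd G S)"
    using assms(9) by (auto simp: nbhd_size_equiv_def)
  interpret G: bipartite_to_tree T G X Y
    using short_cycle_free_axioms assms(1) bip(1)
      diameter_le_3_common_neighbour[OF assms(1,2,4) cards(1) bip(1)]
    by (intro bipartite_to_tree.intro bipartite_to_tree_axioms.intro)
  interpret H: bipartite_to_tree T H X' Y'
    using short_cycle_free_axioms assms(5) bip(2)
      diameter_le_3_common_neighbour[OF assms(5,6,8) cards(2) bip(2)]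
    by (intro bipartite_to_tree.intro bipartite_to_tree_axioms.intro)
  note cong = card_PiE_image_cong[OF G.finite_sides H.finite_sides G.bip_disj H.bip_disj XY,
      of "pverts T"]
  have flat: "card (flat_maps X Y T) = card (flat_maps X' Y' T)"
    unfolding flat_maps_def by (rule cong)
  have flat_star: "card {f \<in> flat_maps X Y T. f ` X \<subseteq> A \<and> f ` Y \<subseteq> B} =
      card {f \<in> flat_maps X' Y' T. f ` X' \<subseteq> A \<and> f ` Y' \<subseteq> B}" for A B
    \<comment> \<open>The predicate is flatness together with the two inclusions, written in terms
      of the images \<open>U\<close> of \<open>X\<close> and \<open>V\<close> of
      \<open>Y\<close>.\<close>
    using cong[of "\<lambda>U V. (((\<exists>c. U \<subseteq> {c}) \<or> (\<exists>c. V \<subseteq> {c})) \<and> U \<times> V \<subseteq> parcs T) \<and> U \<subseteq> A \<and> V \<subseteq> B"]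
    by (simp add: flat_maps_def conj_assoc)
  have star: "card (star_maps G X Y T a b) = card (star_maps H X' Y' T a b)"
    if ab: "(a, b) \<in> parcs T" for a b
    unfolding G.card_star_maps[OF ab] H.card_star_maps[OF ab]
    \<comment> \<open>Reindexing along \<eta> matches the sums term by term, since \<eta> preserves
      the sizes of \<open>S\<close> and of its neighbourhood and the parts \<open>Y\<close> and
      \<open>Y'\<close> have equal size.\<close>
    by (subst sum.reindex_bij_betw[OF \<eta>, symmetric], rule sum.cong) (use size XY in auto)
  show ?thesis
    unfolding G.card_Hom H.card_Hom flat flat_star
    by (intro arg_cong2[where f = "(+)"] sum.cong refl) (auto simp: star)
qed

end
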